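(* Let $m$ be a natural number and let $\widehat{\mathfrak{g}}=\bigoplus_{i=0}^{m-1}\mathfrak{g}_i$ be a finite dimensional perfect $\mathbb{Z}/m\mathbb{Z}$-graded $\mathfrak{F}$-Lie algebra. Let \[ \mathfrak{L}=\bigoplus_{i=1}^{\infty}\mathfrak{g}_i\otimes t^i, \] where $\mathfrak{g}_i=\mathfrak{g}_{i\ (\mathrm{mod}\ m)}$, let $D$ be a positive integer, and let $\mathfrak{h}$ be an $\mathfrak{F}$-subalgebra of finite codimension in $\mathfrak{L}^D$, where $\mathfrak{L}^D$ denotes the direct sum of $D$ copies of $\mathfrak{L}$. Then there exists a constant $C=C(\widehat{\mathfrak{g}})$, depending only on $\widehat{\mathfrak{g}}$ (and not on $D$ or $\mathfrak{h}$), such that \[ \mathrm{codim}_{\mathfrak{L}^D}[\mathfrak{h},\mathfrak{h}]\le C(\mathrm{codim}_{\mathfrak{L}^D}\mathfrak{h}+D). \]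
   Context: $\mathfrak{F}$ denotes the residue field of the maximal unramified extension of a non-archimedean local field, i.e. an algebraic closure of a finite field. A Lie algebra is perfect if it equals its derived algebra. $\mathbb{Z}/m\mathbb{Z}$-graded means $[\mathfrak{g}_i,\mathfrak{g}_j]\subseteq\mathfrak{g}_{i+j\ (\mathrm{mod}\ m)}$. The bracket on $\mathfrak{L}$ is $[x\otimes t^i,y\otimes t^j]=[x,y]\otimes t^{i+j}$. $[\mathfrak{h},\mathfrak{h}]$ is the $\mathfrak{F}$-span of all brackets of elements of $\mathfrak{h}$, and $\mathrm{codim}_{V}U=\dim_{\mathfrak{F}} V/U$. *)

theory Defs
  imports
    "HOL-Computational_Algebra.Polynomial"
    "HOL-Library.Poly_Mapping"
    "HOL-Library.Function_Algebras"
    "HOL-Library.Extended_Nat"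
    "HOL-Library.FuncSet"
begin

text \<open>
  Algebraic closedness comes from the sort; the predicate adds that the field is
  algebraic over one of its finite subfields.
\<close>

definition alg_closure_of_finite_field :: "'f::alg_closed_field itself \<Rightarrow> bool" where
  "alg_closure_of_finite_field _ \<longleftrightarrow>
     (\<exists>K :: 'f set. finite K \<and> 0 \<in> K \<and> 1 \<in> K \<and>
        (\<forall>x\<in>K. \<forall>y\<in>K. x + y \<in> K \<and> x * y \<in> K \<and> - x \<in> K \<and> inverse x \<in> K) \<and>
        (\<forall>x. \<exists>p. p \<noteq> 0 \<and> (\<forall>i. coeff p i \<in> K) \<and> poly p x = 0))"

text \<open>
  The codimension of \<open>U\<close> in \<open>V\<close> is the dimension of \<open>V / U\<close>, with value \<open>\<infinity>\<close> if the quotient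
  is infinite-dimensional. A basis of \<open>V / U\<close> is given by a set of representatives in \<open>V\<close>;
  linear independence modulo \<open>U\<close> forces these to lie in pairwise distinct cosets.
\<close>

definition quotient_basis ::
    "('f::field \<Rightarrow> 'v::ab_group_add \<Rightarrow> 'v) \<Rightarrow> 'v set \<Rightarrow> 'v set \<Rightarrow> 'v set \<Rightarrow> bool" where
  "quotient_basis scale V U B \<longleftrightarrow>
     B \<subseteq> V \<and>
     (\<forall>T c. finite T \<and> T \<subseteq> B \<and> (\<Sum>v\<in>T. scale (c v) v) \<in> U \<longrightarrow> (\<forall>v\<in>T. c v = 0)) \<and>
     (\<forall>x\<in>V. \<exists>T c. finite T \<and> T \<subseteq> B \<and> x - (\<Sum>v\<in>T. scale (c v) v) \<in> U)"

definition codim ::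
    "('f::field \<Rightarrow> 'v::ab_group_add \<Rightarrow> 'v) \<Rightarrow> 'v set \<Rightarrow> 'v set \<Rightarrow> enat" where
  "codim scale V U =
     (if \<exists>B. finite B \<and> quotient_basis scale V U B
      then enat (card (SOME B. finite B \<and> quotient_basis scale V U B)) else \<infinity>)"

text \<open>The codimension does not depend on the basis chosen.\<close>

lemma (in vector_space) codim_eq_card:
  assumes U: "subspace U" and B: "finite B" "quotient_basis scale V U B"
  shows "codim scale V U = enat (card B)"
proof -
  have vs: "vector_space scale" ..
  have vp: "vector_space_pair scale scale"
    by (intro vector_space_pair.intro vs)
  obtain A where A: "A \<subseteq> U" "independent A" "U \<subseteq> span A"
    by (rule basis_exists[of U])
  have spanA: "span A = U"
    using A U span_minimal[of A U] by blast
  define E where "E = extend_basis A"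
  have E: "A \<subseteq> E" "independent E" "span E = UNIV"
    using A(2) by (simp_all add: E_def extend_basis_superset independent_extend_basis)
  define p where "p = vector_space_pair.construct scale scale E (\<lambda>b. if b \<in> A then 0 else b)"
  have lin: "Vector_Spaces.linear scale scale p"
    unfolding p_def by (rule vector_space_pair.linear_construct[OF vp E(2)])
  then have hom: "module_hom scale scale p"
    by (simp add: module_hom_iff_linear)
  note p_simps = module_hom.add[OF hom] module_hom.scale[OF hom] module_hom.diff[OF hom]
    module_hom.sum[OF hom] module_hom.zero[OF hom]
  have pE: "p b = (if b \<in> A then 0 else b)" if "b \<in> E" for b
    unfolding p_def using vector_space_pair.construct_basis[OF vp E(2) that] by simp
  have p_diff: "x - p x \<in> U" for x
  proof -
    have "x \<in> span E" using E by simp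
    then show ?thesis
    proof (induction rule: span_induct_alt)
      case base
      show ?case using U by (simp add: p_simps subspace_0)
    next
      case (step c b y)
      have "b - p b \<in> U"
        using pE[OF step(1)] A(1) U by (auto simp: subspace_0)
      then have "c *s (b - p b) + (y - p y) \<in> U"
        using U step(2) by (intro subspace_add subspace_scale)
      then show ?case
        by (simp add: p_simps algebra_simps scale_right_diff_distrib)
    qed
  qed
  have pU: "p x = 0" if "x \<in> U" for x
  proof -
    have "x \<in> span A" using that spanA by simp
    then show ?thesis
      using module_hom.eq_0_on_span[OF hom, of A] pE E(1) by (metis subsetD)
  qed
  have p0: "p x = 0 \<longleftrightarrow> x \<in> U" for x
    using pU[of x] p_diff[of x] by auto
  have card_eq: "card B' = dim (p ` V)" if B': "finite B'" "quotient_basis scale V U B'" for B'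
  proof -
    have sub: "B' \<subseteq> V"
      and ind: "\<And>T c. finite T \<Longrightarrow> T \<subseteq> B' \<Longrightarrow> (\<Sum>v\<in>T. scale (c v) v) \<in> U \<Longrightarrow> (\<forall>v\<in>T. c v = 0)"
      and gen: "\<And>x. x \<in> V \<Longrightarrow> \<exists>T c. finite T \<and> T \<subseteq> B' \<and> x - (\<Sum>v\<in>T. scale (c v) v) \<in> U"
      using B'(2) unfolding quotient_basis_def by blast+
    have inj: "inj_on p B'"
    proof (rule inj_onI, rule ccontr)
      fix x y assume xy: "x \<in> B'" "y \<in> B'" "p x = p y" "x \<noteq> y"
      have "x - y \<in> U" using xy(3) p0[of "x - y"] by (simp add: p_simps)
      then have "(\<Sum>v\<in>{x, y}. scale (if v = x then 1 else - 1) v) \<in> U"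
        using xy(4) by simp
      from ind[OF _ _ this] xy show False by auto
    qed
    have "independent (p ` B')"
      unfolding dependent_finite[OF finite_imageI[OF B'(1)]]
    proof safe
      fix c b assume b: "b \<in> B'" "c (p b) \<noteq> 0" and s: "(\<Sum>v\<in>p ` B'. scale (c v) v) = 0"
      have "p (\<Sum>v\<in>B'. scale (c (p v)) v) = 0"
        using s inj by (simp add: sum.reindex p_simps)
      then show False
        using ind[OF B'(1) order_refl, of "c \<circ> p"] p0 b by auto
    qed
    moreover have "p ` V \<subseteq> span (p ` B')"
    proof safe
      fix x assume "x \<in> V"
      then obtain T c where T: "finite T" "T \<subseteq> B'" "x - (\<Sum>v\<in>T. scale (c v) v) \<in> U"
        using gen by blast
      then have "p x = (\<Sum>v\<in>T. scale (c v) (p v))"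
        using pU[OF T(3)] by (simp add: p_simps)
      also have "\<dots> \<in> span (p ` B')"
        using T(2) by (intro span_sum span_scale span_base) auto
      finally show "p x \<in> span (p ` B')" .
    qed
    ultimately have "card (p ` B') = dim (p ` V)"
      using sub by (intro basis_card_eq_dim) auto
    then show ?thesis using inj by (simp add: card_image)
  qed
  have "finite (SOME B. finite B \<and> quotient_basis scale V U B) \<and>
        quotient_basis scale V U (SOME B. finite B \<and> quotient_basis scale V U B)"
    using B by (intro someI[of "\<lambda>B. finite B \<and> quotient_basis scale V U B" B]) simp
  then show ?thesis
    using card_eq B unfolding codim_def by auto
qed

locale lie_algebra = vector_space scale
  for scale :: "'f::field \<Rightarrow> 'g::ab_group_add \<Rightarrow> 'g" +
  fixes bracket :: "'g \<Rightarrow> 'g \<Rightarrow> 'g"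
  assumes bracket_linear_left: "Vector_Spaces.linear scale scale (\<lambda>x. bracket x y)"
    and bracket_linear_right: "Vector_Spaces.linear scale scale (\<lambda>y. bracket x y)"
    and bracket_self: "bracket x x = 0"
    and jacobi: "bracket x (bracket y z) + bracket y (bracket z x) + bracket z (bracket x y) = 0"

definition lie_subalgebra ::
    "('f::field \<Rightarrow> 'g::ab_group_add \<Rightarrow> 'g) \<Rightarrow> ('g \<Rightarrow> 'g \<Rightarrow> 'g) \<Rightarrow> 'g set \<Rightarrow> bool" where
  "lie_subalgebra scale bracket H \<longleftrightarrow>
     module.subspace scale H \<and> (\<forall>x\<in>H. \<forall>y\<in>H. bracket x y \<in> H)"

definition derived_algebra ::
    "('f::field \<Rightarrow> 'g::ab_group_add \<Rightarrow> 'g) \<Rightarrow> ('g \<Rightarrow> 'g \<Rightarrow> 'g) \<Rightarrow> 'g set \<Rightarrow> 'g set" where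
  "derived_algebra scale bracket H = module.span scale {bracket x y | x y. x \<in> H \<and> y \<in> H}"

locale graded_lie_algebra = lie_algebra scale bracket
  for scale :: "'f::field \<Rightarrow> 'g::ab_group_add \<Rightarrow> 'g" and bracket :: "'g \<Rightarrow> 'g \<Rightarrow> 'g" +
  fixes m :: nat and G :: "nat \<Rightarrow> 'g set"
  assumes m_pos: "m > 0"
    and grade_subspace: "i < m \<Longrightarrow> subspace (G i)"
    and grade_direct_sum: "\<exists>!f. f \<in> Pi\<^sub>E {..<m} G \<and> x = (\<Sum>i<m. f i)"
    and grade_bracket:
      "i < m \<Longrightarrow> j < m \<Longrightarrow> x \<in> G i \<Longrightarrow> y \<in> G j \<Longrightarrow> bracket x y \<in> G ((i + j) mod m)"

text \<open>
  The finitely supported map \<open>x :: nat \<Rightarrow>\<^sub>0 'g\<close> stands for the sum of the \<open>lookup x i \<otimes> t\<^sup>i\<close>,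
  and \<open>single i a\<close> for \<open>a \<otimes> t\<^sup>i\<close>.
\<close>

definition loop_algebra :: "nat \<Rightarrow> (nat \<Rightarrow> 'g::zero set) \<Rightarrow> (nat \<Rightarrow>\<^sub>0 'g) set" where
  "loop_algebra m G =
     {x. Poly_Mapping.lookup x 0 = 0 \<and> (\<forall>i\<ge>1. Poly_Mapping.lookup x i \<in> G (i mod m))}"

definition loop_scale ::
    "('f \<Rightarrow> 'g::zero \<Rightarrow> 'g) \<Rightarrow> 'f \<Rightarrow> (nat \<Rightarrow>\<^sub>0 'g) \<Rightarrow> (nat \<Rightarrow>\<^sub>0 'g)" where
  "loop_scale scale c x = Poly_Mapping.map (scale c) x"

definition loop_bracket ::
    "('g::ab_group_add \<Rightarrow> 'g \<Rightarrow> 'g) \<Rightarrow> (nat \<Rightarrow>\<^sub>0 'g) \<Rightarrow> (nat \<Rightarrow>\<^sub>0 'g) \<Rightarrow> (nat \<Rightarrow>\<^sub>0 'g)" where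
  "loop_bracket bracket x y =
     (\<Sum>i\<in>Poly_Mapping.keys x. \<Sum>j\<in>Poly_Mapping.keys y.
        Poly_Mapping.single (i + j) (bracket (Poly_Mapping.lookup x i) (Poly_Mapping.lookup y j)))"

text \<open>
  The direct sum of \<open>D\<close> copies consists of families indexed by \<open>k < D\<close>, extended by \<open>0\<close> to all
  of \<open>nat\<close> so that the ambient type does not depend on \<open>D\<close>.
\<close>

definition loop_power ::
    "nat \<Rightarrow> (nat \<Rightarrow> 'g::zero set) \<Rightarrow> nat \<Rightarrow> (nat \<Rightarrow> (nat \<Rightarrow>\<^sub>0 'g)) set" where
  "loop_power m G D = {x. (\<forall>k<D. x k \<in> loop_algebra m G) \<and> (\<forall>k\<ge>D. x k = 0)}"

definition power_scale ::
    "('f \<Rightarrow> 'g::zero \<Rightarrow> 'g) \<Rightarrow> 'f \<Rightarrow> (nat \<Rightarrow> (nat \<Rightarrow>\<^sub>0 'g)) \<Rightarrow> (nat \<Rightarrow> (nat \<Rightarrow>\<^sub>0 'g))" where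
  "power_scale scale c x = (\<lambda>k. loop_scale scale c (x k))"

definition power_bracket ::
    "('g::ab_group_add \<Rightarrow> 'g \<Rightarrow> 'g) \<Rightarrow> (nat \<Rightarrow> (nat \<Rightarrow>\<^sub>0 'g)) \<Rightarrow> (nat \<Rightarrow> (nat \<Rightarrow>\<^sub>0 'g)) \<Rightarrow>
       (nat \<Rightarrow> (nat \<Rightarrow>\<^sub>0 'g))" where
  "power_bracket bracket x y = (\<lambda>k. loop_bracket bracket (x k) (y k))"

end

theory Submission
  imports Defs
begin

text \<open>
  Order the positions \<open>(k, n)\<close> (copy \<open>k\<close>, degree \<open>n\<close>) lexicographically and replace a subspace by its
  spaces of leading coefficients. Call a position bad for \<open>\<hh>\<close> if not all of \<open>\<gg>\<^sub>n\<close> occurs there; elements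
  witnessing badness at distinct positions are independent modulo \<open>\<hh>\<close>, so there are at most
  \<open>codim \<hh>\<close> bad positions, say \<open>c\<^sub>k\<close> of them in copy \<open>k\<close>. By perfectness \<open>\<gg>\<^sub>n\<close> is spanned by the
  \<open>[\<gg>\<^sub>a, \<gg>\<^sub>b]\<close> with \<open>a + b \<equiv> n\<close> modulo \<open>m\<close>. If \<open>n > m (2 c\<^sub>k + 2)\<close>, then for each residue \<open>a\<close> there
  are more than \<open>2 c\<^sub>k\<close> ways to write \<open>n = i + j\<close> with \<open>i, j > 0\<close> and \<open>i \<equiv> a\<close>, and each bad degree spoils
  at most two of them. So \<open>(k, n)\<close> is not bad for \<open>[\<hh>, \<hh>]\<close>, which leaves at most
  \<open>2 m (codim \<hh> + D)\<close> bad positions, each contributing at most the dimension of the algebra.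
\<close>

section \<open>Lower and upper bounds for codimensions\<close>

context vector_space
begin

text \<open>Exchange argument without forming the quotient: each \<open>v\<close> in
  \<open>I\<close> is corrected by some \<open>u v\<close> in \<open>U\<close> so that
  \<open>v - u v\<close> lies in the span of \<open>B\<close>. A basis \<open>A\<close> of the span
  of these corrections is independent jointly with \<open>I\<close>, and \<open>A \<union> I\<close>
  lies in the span of \<open>A \<union> B\<close>, so the cardinality of \<open>A\<close>
  cancels.\<close>

lemma quotient_independent_card_le:
  assumes U: "subspace U" and B: "finite B" "quotient_basis scale V U B"
    and I: "finite I" "I \<subseteq> V"
    and ind: "\<And>c. (\<Sum>v\<in>I. c v *s v) \<in> U \<Longrightarrow> \<forall>v\<in>I. c v = 0"
  shows "card I \<le> card B"
proof -
  have "\<exists>u. u \<in> U \<and> v - u \<in> span B" if "v \<in> I" for v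
  proof -
    have "v \<in> V" using I(2) that by auto
    then obtain T c where T: "finite T" "T \<subseteq> B" "v - (\<Sum>b\<in>T. c b *s b) \<in> U"
      using B(2)[unfolded quotient_basis_def, THEN conjunct2, THEN conjunct2, rule_format, of v]
      by auto
    have "(\<Sum>b\<in>T. c b *s b) \<in> span B"
      using T(2) by (intro span_sum span_scale span_base) auto
    then show ?thesis
      using T(3) by (intro exI[of _ "v - (\<Sum>b\<in>T. c b *s b)"]) simp
  qed
  then obtain u where u: "\<And>v. v \<in> I \<Longrightarrow> u v \<in> U" "\<And>v. v \<in> I \<Longrightarrow> v - u v \<in> span B"
    by metis
  obtain A where A: "A \<subseteq> u ` I" "independent A" "u ` I \<subseteq> span A"
    by (rule basis_exists[of "u ` I"])
  have finA: "finite A" using A(1) I(1) finite_subset by blast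
  have AU: "A \<subseteq> U" using A(1) u(1) by auto
  have disj: "A \<inter> I = {}"
  proof (rule ccontr)
    assume "A \<inter> I \<noteq> {}"
    then obtain a where a: "a \<in> A" "a \<in> I" by blast
    have "(\<Sum>v\<in>I. (if v = a then 1 else 0) *s v) = (\<Sum>v\<in>I. if v = a then v else 0)"
      by (intro sum.cong) auto
    also have "\<dots> = a" using a I(1) by simp
    finally have "(\<Sum>v\<in>I. (if v = a then 1 else 0) *s v) \<in> U" using a AU by auto
    from ind[OF this] a show False by auto
  qed
  have "independent (A \<union> I)"
    unfolding dependent_finite[OF finite_UnI[OF finA I(1)]]
  proof safe
    fix d assume "(\<Sum>v\<in>A \<union> I. d v *s v) = 0"
    then have s: "(\<Sum>v\<in>A. d v *s v) + (\<Sum>v\<in>I. d v *s v) = 0"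
      using disj finA I(1) by (simp add: sum.union_disjoint)
    then have "(\<Sum>v\<in>I. d v *s v) = - (\<Sum>v\<in>A. d v *s v)"
      by (metis add_eq_0_iff)
    also have "\<dots> \<in> U"
      using AU by (intro subspace_neg[OF U] subspace_sum[OF U] subspace_scale[OF U]) auto
    finally have dI: "\<forall>v\<in>I. d v = 0" by (rule ind)
    then have "(\<Sum>v\<in>A. d v *s v) = 0" using s by simp
    then have dA: "\<forall>v\<in>A. d v = 0" using A(2) finA by (auto simp: dependent_finite)
    { fix v assume "v \<in> A" "d v \<noteq> 0" then show False using dA by blast }
    { fix v assume "v \<in> I" "d v \<noteq> 0" then show False using dI by blast }
  qed
  moreover have "A \<union> I \<subseteq> span (A \<union> B)"
  proof -
    have "v \<in> span (A \<union> B)" if "v \<in> I" for v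
    proof -
      have "u v \<in> span (A \<union> B)" "v - u v \<in> span (A \<union> B)"
        using that A(3) u(2)[OF that] span_mono[of A "A \<union> B"] span_mono[of B "A \<union> B"] by auto
      from span_add[OF this] show ?thesis by simp
    qed
    then show ?thesis by (auto intro: span_base)
  qed
  ultimately have "card (A \<union> I) \<le> card (A \<union> B)"
    using independent_span_bound[of "A \<union> B" "A \<union> I"] finA B(1) by auto
  moreover have "card (A \<union> I) = card A + card I"
    using disj finA I(1) by (simp add: card_Un_disjoint)
  moreover have "card (A \<union> B) \<le> card A + card B"
    by (rule card_Un_le)
  ultimately show ?thesis by simp
qed

text \<open>A subset of \<open>S\<close> of least cardinality that still generates \<open>V\<close>
  together with \<open>U\<close> is a basis of the quotient.\<close>

lemma codim_le_card_spanning: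
  assumes U: "subspace U" and S: "finite S" "S \<subseteq> V" "V \<subseteq> span (U \<union> S)"
  shows "codim scale V U \<le> enat (card S)"
proof -
  define P where "P T \<longleftrightarrow> T \<subseteq> S \<and> V \<subseteq> span (U \<union> T)" for T
  obtain T where T: "P T" and min: "\<And>T'. P T' \<Longrightarrow> card T \<le> card T'"
    using exists_least_iff[of "\<lambda>n. \<exists>T. P T \<and> card T = n"] S(3) P_def
    by (metis not_less order_refl)
  have TS: "T \<subseteq> S" and TV: "V \<subseteq> span (U \<union> T)" using T by (auto simp: P_def)
  have finT: "finite T" using TS S(1) finite_subset by blast
  have "quotient_basis scale V U T"
    unfolding quotient_basis_def
  proof (intro conjI allI impI ballI)
    show "T \<subseteq> V" using TS S(2) by blast
  next
    fix Q c w assume Q: "finite Q \<and> Q \<subseteq> T \<and> (\<Sum>v\<in>Q. c v *s v) \<in> U" and w: "w \<in> Q"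
    show "c w = 0"
    proof (rule ccontr)
      assume cw: "c w \<noteq> 0"
      \<comment> \<open>A relation with nonzero coefficient at \<open>w\<close> expresses
        \<open>w\<close> through \<open>U\<close> and the rest of \<open>T\<close>, so
        \<open>w\<close> could be dropped, against minimality.\<close>
      let ?X = "U \<union> (T - {w})"
      have "(\<Sum>v\<in>Q. c v *s v) = c w *s w + (\<Sum>v\<in>Q - {w}. c v *s v)"
        using Q w by (simp add: sum.remove)
      then have "c w *s w = (\<Sum>v\<in>Q. c v *s v) - (\<Sum>v\<in>Q - {w}. c v *s v)" by simp
      also have "\<dots> \<in> span ?X"
      proof (rule span_diff)
        show "(\<Sum>v\<in>Q. c v *s v) \<in> span ?X" using Q by (intro span_base) auto
        show "(\<Sum>v\<in>Q - {w}. c v *s v) \<in> span ?X"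
          using Q by (intro span_sum span_scale span_base) auto
      qed
      finally have "inverse (c w) *s (c w *s w) \<in> span ?X" by (rule span_scale)
      then have "w \<in> span ?X" using cw by simp
      then have "U \<union> T \<subseteq> span ?X" by (auto intro: span_base)
      then have "span (U \<union> T) \<subseteq> span ?X" by (simp add: span_minimal)
      then have "P (T - {w})" using TS TV by (auto simp: P_def)
      from min[OF this] finT Q w show False
        by (metis card_Diff1_less not_less subsetD)
    qed
  next
    fix x assume "x \<in> V"
    then have "x \<in> span (U \<union> T)" using TV by blast
    then obtain a b where ab: "x = a + b" "a \<in> span U" "b \<in> span T"
      unfolding span_Un by blast
    from ab(3) obtain c where "b = (\<Sum>v\<in>T. c v *s v)"
      using span_finite[OF finT] by auto
    then show "\<exists>Q c. finite Q \<and> Q \<subseteq> T \<and> x - (\<Sum>v\<in>Q. c v *s v) \<in> U"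
      using ab span_eq_iff[THEN iffD2, OF U] finT by (intro exI[of _ T] exI[of _ c]) simp
  qed
  then have "codim scale V U = enat (card T)" using codim_eq_card U finT by blast
  then show ?thesis using card_mono[OF S(1) TS] by simp
qed

end

section \<open>Linear structure on the direct sum of loop algebras\<close>

lemma lookup_loop_scale:
  assumes "vector_space scale"
  shows "Poly_Mapping.lookup (loop_scale scale c x) n = scale c (Poly_Mapping.lookup x n)"
proof -
  interpret vector_space scale by fact
  show ?thesis by (simp add: loop_scale_def Poly_Mapping.map.rep_eq when_def)
qed

lemma vector_space_power_scale:
  assumes "vector_space scale"
  shows "vector_space (power_scale scale)"
proof -
  interpret vector_space scale by fact
  show ?thesis
    by unfold_locales
      (auto simp: power_scale_def fun_eq_iff poly_mapping_eq_iff lookup_loop_scale[OF assms]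
        lookup_add algebra_simps scale_left_distrib scale_right_distrib)
qed

section \<open>Splitting a degree into two good degrees\<close>

lemma exists_good_in_progression:
  fixes m a n :: nat
  assumes "finite B" "m > 0" "a < m" "n > m * (2 * card B + 2)"
  shows "\<exists>i j. 0 < i \<and> 0 < j \<and> i + j = n \<and> i mod m = a \<and> i \<notin> B \<and> j \<notin> B"
proof (rule ccontr)
  assume contra: "\<not> ?thesis"
  \<comment> \<open>Starting at 1 keeps \<open>i = a + m * q\<close> positive even for
    \<open>a = 0\<close>. The upper end keeps \<open>i\<close> below
    \<open>m * (2 * card B + 2)\<close>, hence \<open>n - i\<close> positive, and leaves one
    candidate more than the \<open>2 * card B\<close> that can be spoiled.\<close>
  let ?Q = "{1..2 * card B + 1}"
  define f where "f q = a + m * q" for q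
  have lt: "f q < n" if "q \<in> ?Q" for q
  proof -
    have "m * q \<le> m * (2 * card B + 1)" using that by (intro mult_left_mono) auto
    then show ?thesis using assms by (simp add: f_def algebra_simps)
  qed
  have inj1: "inj_on f ?Q" using assms(2) by (auto simp: f_def inj_on_def)
  have inj2: "inj_on (\<lambda>q. n - f q) ?Q"
  proof (rule inj_onI)
    fix x y assume xy: "x \<in> ?Q" "y \<in> ?Q" "n - f x = n - f y"
    then have "f x = f y" using lt[OF xy(1)] lt[OF xy(2)] by linarith
    then show "x = y" by (rule inj_onD[OF inj1 _ xy(1,2)])
  qed
  have "?Q \<subseteq> {q \<in> ?Q. f q \<in> B} \<union> {q \<in> ?Q. n - f q \<in> B}"
  proof
    fix q assume q: "q \<in> ?Q"
    have "f q > 0" using q assms(2) by (auto simp: f_def)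
    moreover have "f q mod m = a" using assms by (simp add: f_def)
    ultimately show "q \<in> {q \<in> ?Q. f q \<in> B} \<union> {q \<in> ?Q. n - f q \<in> B}"
      using contra lt[OF q] q by (force dest: spec[of _ "f q"])
  qed
  then have "card ?Q \<le> card ({q \<in> ?Q. f q \<in> B} \<union> {q \<in> ?Q. n - f q \<in> B})"
    by (intro card_mono) auto
  also have "\<dots> \<le> card {q \<in> ?Q. f q \<in> B} + card {q \<in> ?Q. n - f q \<in> B}"
    by (rule card_Un_le)
  also have "card {q \<in> ?Q. f q \<in> B} \<le> card B"
    using assms(1) by (intro card_inj_on_le[of f]) (auto intro: inj_on_subset[OF inj1])
  also have "card {q \<in> ?Q. n - f q \<in> B} \<le> card B"
    using assms(1) by (intro card_inj_on_le[of "\<lambda>q. n - f q"]) (auto intro: inj_on_subset[OF inj2])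
  finally show False by simp
qed

section \<open>Leading coefficients in the lexicographic order\<close>

definition lead_below :: "nat \<Rightarrow> nat \<Rightarrow> (nat \<Rightarrow> nat \<Rightarrow>\<^sub>0 'g::zero) \<Rightarrow> bool" where
  "lead_below k n x \<longleftrightarrow> (\<forall>k'>k. x k' = 0) \<and> (\<forall>n'\<ge>n. Poly_Mapping.lookup (x k) n' = 0)"

text \<open>\<open>lead_below\<close> is a strict bound, so \<open>Suc n\<close> admits a leading term at \<open>(k, n)\<close> itself.\<close>

definition leads :: "(nat \<Rightarrow> nat \<Rightarrow>\<^sub>0 'g::zero) set \<Rightarrow> nat \<Rightarrow> nat \<Rightarrow> 'g set" where
  "leads U k n = {Poly_Mapping.lookup (x k) n | x. x \<in> U \<and> lead_below k (Suc n) x}"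

definition monomial :: "nat \<Rightarrow> nat \<Rightarrow> 'g \<Rightarrow> nat \<Rightarrow> nat \<Rightarrow>\<^sub>0 'g::zero" where
  "monomial k n a = (\<lambda>k'. if k' = k then Poly_Mapping.single n a else 0)"

lemma lookup_monomial:
  "Poly_Mapping.lookup (monomial k n a k') n' = (if k' = k \<and> n' = n then a else 0)"
  by (simp add: monomial_def lookup_single when_def)

lemma monomial_apply_other: "k' \<noteq> k \<Longrightarrow> monomial k n a k' = 0"
  by (simp add: monomial_def)

lemma lookup_sum_apply: "Poly_Mapping.lookup ((\<Sum>i\<in>A. f i) k) n = (\<Sum>i\<in>A. Poly_Mapping.lookup (f i k) n)"
  by (induction A rule: infinite_finite_induct) (auto simp: lookup_add)

section \<open>The Lie bracket on the direct sum and its leading coefficients\<close>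

context graded_lie_algebra
begin

interpretation V: vector_space "power_scale scale"
  by (rule vector_space_power_scale) unfold_locales

lemma lookup_power_scale: "Poly_Mapping.lookup (power_scale scale c x k) n = scale c (Poly_Mapping.lookup (x k) n)"
  unfolding power_scale_def by (rule lookup_loop_scale) unfold_locales

lemma bracket_zero_left [simp]: "bracket 0 z = 0"
  and bracket_zero_right [simp]: "bracket z 0 = 0"
  and bracket_sum_left: "bracket (\<Sum>i\<in>A. f i) z = (\<Sum>i\<in>A. bracket (f i) z)"
  and bracket_sum_right: "bracket z (\<Sum>i\<in>A. f i) = (\<Sum>i\<in>A. bracket z (f i))"
proof -
  note l = bracket_linear_left[of z, folded module_hom_iff_linear]
    and r = bracket_linear_right[of z, folded module_hom_iff_linear]
  show "bracket 0 z = 0" using module_hom.zero[OF l] .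
  show "bracket z 0 = 0" using module_hom.zero[OF r] .
  show "bracket (\<Sum>i\<in>A. f i) z = (\<Sum>i\<in>A. bracket (f i) z)" using module_hom.sum[OF l] .
  show "bracket z (\<Sum>i\<in>A. f i) = (\<Sum>i\<in>A. bracket z (f i))" using module_hom.sum[OF r] .
qed

lemma lookup_power_bracket:
  "Poly_Mapping.lookup (power_bracket bracket x y k) n =
    (\<Sum>i\<in>Poly_Mapping.keys (x k). \<Sum>j\<in>Poly_Mapping.keys (y k).
       bracket (Poly_Mapping.lookup (x k) i) (Poly_Mapping.lookup (y k) j) when i + j = n)"
  by (simp add: power_bracket_def loop_bracket_def lookup_sum lookup_single)

lemma subspace_loop_power: "V.subspace (loop_power m G D)"
  unfolding V.subspace_def
  using m_pos subspace_0[OF grade_subspace] subspace_add[OF grade_subspace]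
    subspace_scale[OF grade_subspace]
  by (auto simp: loop_power_def loop_algebra_def lookup_add lookup_power_scale
      poly_mapping_eq_iff[of _ 0] fun_eq_iff[of _ "\<lambda>x. 0"] zero_poly_mapping.rep_eq)

text \<open>Places the derived algebra of \<open>H\<close> inside the space in which its codimension
  is measured.\<close>

lemma power_bracket_in_loop_power:
  assumes x: "x \<in> loop_power m G D" and y: "y \<in> loop_power m G D"
  shows "power_bracket bracket x y \<in> loop_power m G D"
proof -
  have pos: "0 < i" "Poly_Mapping.lookup (z k) i \<in> G (i mod m)"
    if "z \<in> loop_power m G D" "k < D" "i \<in> Poly_Mapping.keys (z k)" for z :: "nat \<Rightarrow> nat \<Rightarrow>\<^sub>0 'g" and k i
  proof -
    have z: "Poly_Mapping.lookup (z k) 0 = 0" "\<forall>i\<ge>1. Poly_Mapping.lookup (z k) i \<in> G (i mod m)"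
      using that by (auto simp: loop_power_def loop_algebra_def)
    show "0 < i" using z(1) that(3) by (metis in_keys_iff neq0_conv)
    then show "Poly_Mapping.lookup (z k) i \<in> G (i mod m)" using z(2) by auto
  qed
  \<comment> \<open>Both factors live in positive degrees, so no pair of degrees sums to 0.\<close>
  have "Poly_Mapping.lookup (power_bracket bracket x y k) 0 = 0" if "k < D" for k
    unfolding lookup_power_bracket
    using pos(1)[OF x that] by (intro sum.neutral ballI) auto
  moreover have "Poly_Mapping.lookup (power_bracket bracket x y k) n \<in> G (n mod m)" if k: "k < D" for k n
    unfolding lookup_power_bracket
  proof (intro subspace_sum grade_subspace)
    fix i j assume ij: "i \<in> Poly_Mapping.keys (x k)" "j \<in> Poly_Mapping.keys (y k)"
    show "(bracket (Poly_Mapping.lookup (x k) i) (Poly_Mapping.lookup (y k) j) when i + j = n) \<in> G (n mod m)"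
      using grade_bracket[OF _ _ pos(2)[OF x k ij(1)] pos(2)[OF y k ij(2)]] m_pos
        subspace_0[OF grade_subspace, of "n mod m"]
      by (auto simp: when_def mod_add_eq)
  qed (use m_pos in auto)
  moreover have "power_bracket bracket x y k = 0" if "k \<ge> D" for k
    using x that by (simp add: loop_power_def power_bracket_def loop_bracket_def)
  ultimately show ?thesis by (auto simp: loop_power_def loop_algebra_def)
qed

text \<open>\<open>leads\<close> admits elements whose coefficient at \<open>(k, n)\<close>
  vanishes, so cancellation of leading terms under addition needs no separate case.\<close>

lemma subspace_leads:
  assumes U: "V.subspace U"
  shows "subspace (leads U k n)"
proof (rule subspaceI)
  show "0 \<in> leads U k n"
    using V.subspace_0[OF U] unfolding leads_def lead_below_def by (auto intro!: exI[of _ 0])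
next
  fix a b assume "a \<in> leads U k n" "b \<in> leads U k n"
  then obtain x y where "x \<in> U" "lead_below k (Suc n) x" "a = Poly_Mapping.lookup (x k) n"
    "y \<in> U" "lead_below k (Suc n) y" "b = Poly_Mapping.lookup (y k) n"
    unfolding leads_def by blast
  then show "a + b \<in> leads U k n"
    using V.subspace_add[OF U] unfolding leads_def lead_below_def
    by (auto intro!: exI[of _ "x + y"] simp: lookup_add)
next
  fix c a assume "a \<in> leads U k n"
  then obtain x where x: "x \<in> U" "lead_below k (Suc n) x" "a = Poly_Mapping.lookup (x k) n"
    unfolding leads_def by blast
  then have "lead_below k (Suc n) (power_scale scale c x)"
    by (auto simp: lead_below_def poly_mapping_eq_iff fun_eq_iff lookup_power_scale)
  then show "scale c a \<in> leads U k n"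
    using x V.subspace_scale[OF U] unfolding leads_def
    by (auto intro!: exI[of _ "power_scale scale c x"] simp: lookup_power_scale)
qed

text \<open>Brackets are formed copy by copy, so nothing appears above copy \<open>k\<close>. Inside
  it the degrees are at most \<open>i\<close> and \<open>j\<close>, and only the pair
  \<open>(i, j)\<close> itself can contribute to degree \<open>i + j\<close>.\<close>

lemma leads_bracket:
  assumes a: "a \<in> leads H k i" and b: "b \<in> leads H k j"
  shows "bracket a b \<in> leads (derived_algebra (power_scale scale) (power_bracket bracket) H) k (i + j)"
proof -
  obtain x y where x: "x \<in> H" "lead_below k (Suc i) x" "a = Poly_Mapping.lookup (x k) i"
    and y: "y \<in> H" "lead_below k (Suc j) y" "b = Poly_Mapping.lookup (y k) j"
    using a b unfolding leads_def by blast
  let ?z = "power_bracket bracket x y"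
  have bx: "i' \<le> i" if "i' \<in> Poly_Mapping.keys (x k)" for i'
    using x(2) that unfolding lead_below_def by (metis in_keys_iff not_less_eq_eq)
  have by': "j' \<le> j" if "j' \<in> Poly_Mapping.keys (y k)" for j'
    using y(2) that unfolding lead_below_def by (metis in_keys_iff not_less_eq_eq)
  have "?z k' = 0" if "k' > k" for k'
    using x(2) that by (simp add: lead_below_def power_bracket_def loop_bracket_def)
  moreover have "Poly_Mapping.lookup (?z k) n = 0" if "n \<ge> Suc (i + j)" for n
    unfolding lookup_power_bracket using that
    by (intro sum.neutral ballI) (auto simp: when_def dest!: bx by')
  ultimately have below: "lead_below k (Suc (i + j)) ?z" by (simp add: lead_below_def)
  have "Poly_Mapping.lookup (?z k) (i + j) =
      (\<Sum>i'\<in>Poly_Mapping.keys (x k). \<Sum>j'\<in>Poly_Mapping.keys (y k). if i' = i then if j' = j then bracket a b else 0 else 0)"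
    unfolding lookup_power_bracket
    by (intro sum.cong) (auto simp: when_def x(3) y(3) dest!: bx by')
  also have "\<dots> = (\<Sum>i'\<in>Poly_Mapping.keys (x k). if i' = i then \<Sum>j'\<in>Poly_Mapping.keys (y k). if j' = j then bracket a b else 0 else 0)"
    by (intro sum.cong) auto
  \<comment> \<open>If \<open>i\<close> or \<open>j\<close> is not a key, then \<open>a\<close> or
    \<open>b\<close> is 0 and both sides vanish.\<close>
  also have "\<dots> = bracket a b"
    by (auto simp: in_keys_iff x(3) y(3))
  finally have "Poly_Mapping.lookup (?z k) (i + j) = bracket a b" .
  moreover have "?z \<in> derived_algebra (power_scale scale) (power_bracket bracket) H"
    unfolding derived_algebra_def using x(1) y(1) by (auto intro!: V.span_base)
  ultimately show ?thesis using below unfolding leads_def by force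
qed

section \<open>Perfectness degree by degree\<close>

lemma grade_sum_unique:
  assumes "\<And>i. i < m \<Longrightarrow> s i \<in> G i" "r < m" "x \<in> G r" "x = (\<Sum>i<m. s i)"
  shows "x = s r"
proof -
  define f where "f = restrict s {..<m}"
  \<comment> \<open>The competing decomposition of \<open>x\<close>, concentrated in degree
    \<open>r\<close>.\<close>
  define g where "g = restrict (\<lambda>i. if i = r then x else 0) {..<m}"
  have "f \<in> Pi\<^sub>E {..<m} G \<and> x = (\<Sum>i<m. f i)" using assms by (auto simp: f_def)
  moreover have "g \<in> Pi\<^sub>E {..<m} G \<and> x = (\<Sum>i<m. g i)"
    using assms subspace_0[OF grade_subspace] by (auto simp: g_def)
  ultimately have "f = g" using grade_direct_sum by blast
  then have "f r = g r" by simp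
  then show ?thesis using assms(2) by (simp add: f_def g_def)
qed

text \<open>Splitting both arguments of a bracket into homogeneous parts and collecting terms by
  total degree writes every element as a sum of components in the spans \<open>S r\<close>. For an
  element of \<open>G r\<close>, uniqueness of the decomposition leaves only the component at
  \<open>r\<close>.\<close>

lemma perfect_grade_span:
  assumes perfect: "derived_algebra scale bracket UNIV = UNIV" and r: "r < m"
  shows "G r \<subseteq> span {bracket x y | x y a b.
           a < m \<and> b < m \<and> (a + b) mod m = r \<and> x \<in> G a \<and> y \<in> G b}"
proof -
  define S where "S r = span {bracket x y | x y a b.
           a < m \<and> b < m \<and> (a + b) mod m = r \<and> x \<in> G a \<and> y \<in> G b}" for r
  have SG: "S r \<subseteq> G r" if "r < m" for r
    unfolding S_def using that grade_bracket by (intro span_minimal grade_subspace) auto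
  have decomp: "\<exists>s. (\<forall>r<m. s r \<in> S r) \<and> x = (\<Sum>r<m. s r)" for x
  proof -
    have "x \<in> span {bracket x y | x y. x \<in> UNIV \<and> y \<in> UNIV}"
      using perfect unfolding derived_algebra_def by auto
    then show ?thesis
    proof (induction rule: span_induct_alt)
      case base
      show ?case by (auto intro!: exI[of _ "\<lambda>_. 0"] simp: S_def span_zero)
    next
      case (step c z w)
      obtain x y where z: "z = bracket x y" using step(1) by blast
      obtain f where f: "f \<in> Pi\<^sub>E {..<m} G" "x = (\<Sum>i<m. f i)" using grade_direct_sum by blast
      obtain g where g: "g \<in> Pi\<^sub>E {..<m} G" "y = (\<Sum>i<m. g i)" using grade_direct_sum by blast
      obtain s where s: "\<forall>r<m. s r \<in> S r" "w = (\<Sum>r<m. s r)" using step(2) by blast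
      define t where "t r = (\<Sum>a<m. \<Sum>b<m. bracket (f a) (g b) when (a + b) mod m = r)" for r
      have "z = (\<Sum>a<m. \<Sum>b<m. bracket (f a) (g b))"
        unfolding z f(2) g(2) by (simp only: bracket_sum_left bracket_sum_right) (rule sum.swap)
      \<comment> \<open>Exactly one \<open>r < m\<close> is the residue of \<open>a + b\<close>, so
        the inserted sum changes nothing; it prepares the regrouping by \<open>r\<close>.\<close>
      also have "\<dots> = (\<Sum>a<m. \<Sum>b<m. \<Sum>r<m. bracket (f a) (g b) when (a + b) mod m = r)"
        using m_pos by (simp add: when_def)
      also have "\<dots> = (\<Sum>a<m. \<Sum>r<m. \<Sum>b<m. bracket (f a) (g b) when (a + b) mod m = r)"
        by (intro sum.cong refl sum.swap)
      also have "\<dots> = (\<Sum>r<m. t r)" unfolding t_def by (rule sum.swap)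
      finally have z_eq: "z = (\<Sum>r<m. t r)" .
      have t: "t r \<in> S r" if "r < m" for r
        unfolding t_def
      proof (intro subspace_sum[of "S r"])
        fix a b assume ab: "a \<in> {..<m}" "b \<in> {..<m}"
        show "(bracket (f a) (g b) when (a + b) mod m = r) \<in> S r"
        proof (cases "(a + b) mod m = r")
          case True
          have "f a \<in> G a" "g b \<in> G b" using ab f(1) g(1) by auto
          then have "bracket (f a) (g b) \<in> S r"
            unfolding S_def using ab True by (intro span_base) blast
          then show ?thesis using True by simp
        qed (simp add: S_def span_zero)
      qed (simp_all add: S_def)
      have "scale c z + w = (\<Sum>r<m. scale c (t r) + s r)"
        by (simp add: z_eq s(2) sum.distrib scale_sum_right)
      moreover have "scale c (t r) + s r \<in> S r" if "r < m" for r
        using t[OF that] s(1) that unfolding S_def by (intro span_add span_scale) auto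
      ultimately show ?case by (intro exI[of _ "\<lambda>r. scale c (t r) + s r"]) auto
    qed
  qed
  show ?thesis
  proof
    fix x assume x: "x \<in> G r"
    obtain s where s: "\<forall>r<m. s r \<in> S r" "x = (\<Sum>r<m. s r)" using decomp by blast
    have "x = s r" using grade_sum_unique[of s r x] SG s x r by auto
    then show "x \<in> span {bracket x y | x y a b.
           a < m \<and> b < m \<and> (a + b) mod m = r \<and> x \<in> G a \<and> y \<in> G b}"
      using s(1) r unfolding S_def by auto
  qed
qed

section \<open>Counting bad positions\<close>

text \<open>Degree 0 is left out because all elements of \<open>loop_power m G D\<close> vanish
  there.\<close>

definition bad_positions :: "nat \<Rightarrow> (nat \<Rightarrow> nat \<Rightarrow>\<^sub>0 'g) set \<Rightarrow> (nat \<times> nat) set" where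
  "bad_positions D U = {(k, n). k < D \<and> 0 < n \<and> \<not> G (n mod m) \<subseteq> leads U k n}"

lemma monomial_in_loop_power:
  assumes "k < D" "0 < n" "a \<in> G (n mod m)"
  shows "monomial k n a \<in> loop_power m G D"
  using assms subspace_0[OF grade_subspace] m_pos
  by (auto simp: loop_power_def loop_algebra_def lookup_monomial) (simp add: monomial_def)

text \<open>Each bad position carries a monomial whose coefficient is not a leading coefficient of
  \<open>H\<close>. These monomials are independent modulo \<open>H\<close>: a nontrivial
  combination in \<open>H\<close> would have a nonzero multiple of such a coefficient as its leading
  one. Finite subsets come first, since finiteness of the whole set is only deduced from this
  bound.\<close>

lemma finite_subset_bad_positions_card_le:
  assumes H: "V.subspace H" and B: "finite B" "quotient_basis (power_scale scale) (loop_power m G D) H B"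
    and P: "finite P" "P \<subseteq> bad_positions D H"
  shows "card P \<le> card B"
proof -
  have "\<exists>a. a \<in> G (snd p mod m) \<and> a \<notin> leads H (fst p) (snd p)" if "p \<in> P" for p
    using P(2) that by (auto simp: bad_positions_def)
  then obtain a where a: "\<And>p. p \<in> P \<Longrightarrow> a p \<in> G (snd p mod m)"
      "\<And>p. p \<in> P \<Longrightarrow> a p \<notin> leads H (fst p) (snd p)"
    by metis
  define v where "v p = monomial (fst p) (snd p) (a p)" for p
  \<comment> \<open>\<open>leads\<close> always contains 0, so a coefficient outside it is
    nonzero.\<close>
  have a0: "a p \<noteq> 0" if "p \<in> P" for p
    using a(2)[OF that] subspace_0[OF subspace_leads[OF H]] by metis
  have inj: "inj_on v P"
  proof (rule inj_onI)
    fix p q assume pq: "p \<in> P" "q \<in> P" "v p = v q"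
    have "Poly_Mapping.lookup (v p (fst p)) (snd p) \<noteq> 0"
      using a0 pq(1) by (simp add: v_def lookup_monomial)
    then have "Poly_Mapping.lookup (v q (fst p)) (snd p) \<noteq> 0" by (simp add: pq(3))
    then show "p = q" by (auto simp: v_def lookup_monomial prod_eq_iff split: if_splits)
  qed
  have vV: "v ` P \<subseteq> loop_power m G D"
    using P(2) a(1) by (auto simp: v_def bad_positions_def intro!: monomial_in_loop_power)
  have "card (v ` P) \<le> card B"
  proof (rule V.quotient_independent_card_le[OF H B _ vV])
    show "finite (v ` P)" using P(1) by simp
    fix c assume "(\<Sum>w\<in>v ` P. power_scale scale (c w) w) \<in> H"
    then have sH: "(\<Sum>p\<in>P. power_scale scale (c (v p)) (v p)) \<in> H" (is "?s \<in> H")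
      using inj by (simp add: sum.reindex)
    have s_coeff: "Poly_Mapping.lookup (?s k) n = (if (k, n) \<in> P then scale (c (v (k, n))) (a (k, n)) else 0)" for k n
    proof -
      have "Poly_Mapping.lookup (?s k) n = (\<Sum>p\<in>P. if p = (k, n) then scale (c (v p)) (a p) else 0)"
        unfolding lookup_sum_apply
        by (intro sum.cong) (auto simp: lookup_power_scale v_def lookup_monomial)
      then show ?thesis using P(1) by simp
    qed
    define Q where "Q = {p \<in> P. c (v p) \<noteq> 0}"
    have "Q = {}"
    proof (rule ccontr)
      assume ne: "Q \<noteq> {}"
      have finQ: "finite Q" using P(1) by (simp add: Q_def)
      \<comment> \<open>The lexicographically largest position with nonzero coefficient: first the
        top copy, then the top degree in it.\<close>
      define k where "k = Max (fst ` Q)"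
      define n where "n = Max {n. (k, n) \<in> Q}"
      have "k \<in> fst ` Q" unfolding k_def using finQ ne by (intro Max_in) auto
      then have ne': "{n. (k, n) \<in> Q} \<noteq> {}" by auto
      have "{n. (k, n) \<in> Q} \<subseteq> snd ` Q" by force
      then have fin': "finite {n. (k, n) \<in> Q}" using finQ finite_surj by blast
      have kn: "(k, n) \<in> Q" using Max_in[OF fin' ne'] by (simp add: n_def)
      have k_max: "k' \<le> k" if "(k', n') \<in> Q" for k' n'
        unfolding k_def using finQ that by (intro Max_ge) force+
      have n_max: "n' \<le> n" if "(k, n') \<in> Q" for n'
        unfolding n_def using fin' that by (intro Max_ge) auto
      have "?s k' = 0" if "k' > k" for k'
      proof (rule poly_mapping_eqI)
        fix n' show "Poly_Mapping.lookup (?s k') n' = Poly_Mapping.lookup 0 n'"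
          using k_max[of k' n'] that by (auto simp: s_coeff Q_def)
      qed
      moreover have "Poly_Mapping.lookup (?s k) n' = 0" if "n' \<ge> Suc n" for n'
        using n_max[of n'] that by (auto simp: s_coeff Q_def)
      ultimately have "lead_below k (Suc n) ?s" by (auto simp: lead_below_def)
      then have "Poly_Mapping.lookup (?s k) n \<in> leads H k n" using sH unfolding leads_def by blast
      then have "scale (c (v (k, n))) (a (k, n)) \<in> leads H k n"
        using kn by (simp add: s_coeff Q_def)
      from subspace_scale[OF subspace_leads[OF H] this, of "inverse (c (v (k, n)))"]
      have "a (k, n) \<in> leads H k n" using kn by (simp add: Q_def)
      then show False using a(2)[of "(k, n)"] kn by (simp add: Q_def)
    qed
    then show "\<forall>w\<in>v ` P. c w = 0" by (auto simp: Q_def)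
  qed
  then show ?thesis using inj by (simp add: card_image)
qed

lemma bad_positions_card_le:
  assumes "V.subspace H" "finite B" "quotient_basis (power_scale scale) (loop_power m G D) H B"
  shows "finite (bad_positions D H) \<and> card (bad_positions D H) \<le> card B"
  using finite_subset_bad_positions_card_le[OF assms] by (intro finite_if_finite_subsets_card_bdd) blast

text \<open>For residues \<open>a\<close>, \<open>b\<close> with sum congruent to \<open>n\<close>,
  a splitting of \<open>n\<close> into degrees good for \<open>H\<close> makes all brackets of
  \<open>G a\<close> with \<open>G b\<close> leading coefficients of the derived algebra. The
  splitting may vary with the residues: all these brackets lie in one subspace \<open>leads\<close>,
  which then contains their span.\<close>

lemma bad_positions_derived:
  assumes perfect: "derived_algebra scale bracket UNIV = UNIV"
    and fin: "finite (bad_positions D H)"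
    and kn: "(k, n) \<in> bad_positions D (derived_algebra (power_scale scale) (power_bracket bracket) H)"
  shows "n \<le> m * (2 * card {i. (k, i) \<in> bad_positions D H} + 2)"
proof (rule ccontr)
  let ?H' = "derived_algebra (power_scale scale) (power_bracket bracket) H"
  let ?B = "{i. (k, i) \<in> bad_positions D H}"
  assume "\<not> ?thesis"
  then have n: "n > m * (2 * card ?B + 2)" by simp
  have "?B \<subseteq> snd ` bad_positions D H" by force
  then have finB: "finite ?B" using fin finite_surj by blast
  have k: "k < D" and n0: "0 < n" and bad: "\<not> G (n mod m) \<subseteq> leads ?H' k n"
    using kn by (auto simp: bad_positions_def)
  have sub: "subspace (leads ?H' k n)"
    by (intro subspace_leads) (simp add: derived_algebra_def)
  have "bracket x y \<in> leads ?H' k n"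
    if ab: "a < m" "b < m" "(a + b) mod m = n mod m" "x \<in> G a" "y \<in> G b" for x y a b
  proof -
    obtain i j where ij: "0 < i" "0 < j" "i + j = n" "i mod m = a" "i \<notin> ?B" "j \<notin> ?B"
      using exists_good_in_progression[OF finB m_pos ab(1) n] by blast
    \<comment> \<open>Only the residue of \<open>i\<close> was prescribed. That of \<open>j\<close>
      is forced by cancelling \<open>i\<close>, which is done in the integers.\<close>
    have "(i + j) mod m = (i + b) mod m"
      using ij(3,4) ab(3) by (metis mod_add_left_eq)
    then have "int (i + j) mod int m = int (i + b) mod int m"
      by (metis of_nat_mod)
    then have "int j mod int m = int b mod int m"
      by (simp add: mod_eq_dvd_iff)
    then have "j mod m = b"
      using ab(2) by (metis mod_less of_nat_eq_iff of_nat_mod)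
    then have "x \<in> leads H k i" "y \<in> leads H k j"
      using ij ab k by (auto simp: bad_positions_def)
    then show ?thesis using leads_bracket ij(3) by metis
  qed
  then have "span {bracket x y | x y a b.
      a < m \<and> b < m \<and> (a + b) mod m = n mod m \<and> x \<in> G a \<and> y \<in> G b} \<subseteq> leads ?H' k n"
    by (intro span_minimal sub) blast
  then show False using bad perfect_grade_span[OF perfect, of "n mod m"] m_pos by auto
qed

text \<open>Summing the degree bound over the copies turns the numbers of bad degrees into
  \<open>card (bad_positions D H)\<close>, while the constant 2 in each copy produces the summand
  \<open>D\<close>.\<close>

lemma card_bad_positions_derived:
  assumes perfect: "derived_algebra scale bracket UNIV = UNIV"
    and fin: "finite (bad_positions D H)"
  defines "H' \<equiv> derived_algebra (power_scale scale) (power_bracket bracket) H"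
  shows "finite (bad_positions D H') \<and>
    card (bad_positions D H') \<le> 2 * m * (card (bad_positions D H) + D)"
proof -
  define R where "R k = {i. (k, i) \<in> bad_positions D H}" for k
  let ?S = "SIGMA k:{..<D}. {1..m * (2 * card (R k) + 2)}"
  have bad: "bad_positions D H = (SIGMA k:{..<D}. R k)"
    by (auto simp: bad_positions_def R_def)
  have finR: "finite (R k)" for k
  proof -
    have "R k \<subseteq> snd ` bad_positions D H" unfolding R_def by force
    then show ?thesis using fin finite_surj by blast
  qed
  have sub: "bad_positions D H' \<subseteq> ?S"
    using bad_positions_derived[OF perfect fin] unfolding H'_def R_def
    by (auto simp: Suc_le_eq) (auto simp: bad_positions_def)
  have "card ?S = (\<Sum>k<D. m * (2 * card (R k) + 2))" by simp
  also have "\<dots> = 2 * m * ((\<Sum>k<D. card (R k)) + D)"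
    by (simp add: sum_distrib_left sum.distrib algebra_simps)
  also have "(\<Sum>k<D. card (R k)) = card (bad_positions D H)"
    using finR by (simp add: bad)
  finally have "card ?S = 2 * m * (card (bad_positions D H) + D)" .
  moreover have "finite ?S" by auto
  ultimately show ?thesis using sub by (metis card_mono finite_subset)
qed

section \<open>Elimination of leading terms\<close>

lemma monomial_in_span:
  assumes "a \<in> span A"
  shows "monomial k n a \<in> V.span (monomial k n ` A)"
  using assms
proof (induction rule: span_induct_alt)
  case base
  have "monomial k n 0 = (0 :: nat \<Rightarrow> nat \<Rightarrow>\<^sub>0 'g)" by (simp add: monomial_def fun_eq_iff)
  then show ?case using V.span_zero by metis
next
  case (step c x y)
  have "monomial k n (scale c x + y) = power_scale scale c (monomial k n x) + monomial k n y"
    by (auto simp: fun_eq_iff poly_mapping_eq_iff lookup_add lookup_power_scale lookup_monomial)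
  also have "\<dots> \<in> V.span (monomial k n ` A)"
    using step by (intro V.span_add V.span_scale) (auto intro: V.span_base)
  finally show ?case .
qed

text \<open>Leading terms are removed from the top down. Clearing a copy may introduce terms of any
  degree in lower copies, so the induction is nested: outside on the number of copies, inside on the
  degree bound in the top copy.\<close>

lemma loop_power_subset_span:
  assumes U: "V.subspace U" "U \<subseteq> loop_power m G D"
    and A: "\<And>n. G (n mod m) \<subseteq> span (A n)"
  defines "S \<equiv> \<Union>(k, n)\<in>bad_positions D U. monomial k n ` A n"
  shows "loop_power m G D \<subseteq> V.span (U \<union> S)"
proof -
  have outer: "x \<in> V.span (U \<union> S)"
    if "K \<le> D" "x \<in> loop_power m G D" "\<And>k. k \<ge> K \<Longrightarrow> x k = 0" for K x
    using that
  proof (induction K arbitrary: x)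
    case 0
    then have "x = 0" by (simp add: fun_eq_iff)
    then show ?case using V.span_zero by metis
  next
    case (Suc K)
    have inner: "x \<in> V.span (U \<union> S)" if "x \<in> loop_power m G D" "lead_below K n x" for n x
      using that
    proof (induction n arbitrary: x)
      case 0
      \<comment> \<open>Bound 0 means that copy \<open>K\<close> is cleared, so the outer hypothesis
        applies.\<close>
      then have "x k = 0" if "k \<ge> K" for k
        using that by (cases "k = K") (auto simp: lead_below_def intro: poly_mapping_eqI)
      then show ?case using Suc.IH[of x] Suc.prems(1) "0.prems" by auto
    next
      case (Suc n)
      have K: "K < D" using \<open>Suc K \<le> D\<close> by simp
      let ?a = "Poly_Mapping.lookup (x K) n"
      \<comment> \<open>The vector to subtract: 0 in degree 0, a monomial at a bad position, an
        element of \<open>U\<close> at a good one.\<close>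
      have "\<exists>u \<in> V.span (U \<union> S). u \<in> loop_power m G D \<and> lead_below K (Suc n) u \<and> Poly_Mapping.lookup (u K) n = ?a"
      proof (cases "n = 0")
        case True
        then have "?a = 0" using Suc.prems(1) K by (simp add: loop_power_def loop_algebra_def)
        then show ?thesis
          using V.span_zero V.subspace_0[OF subspace_loop_power]
          by (intro bexI[of _ 0]) (auto simp: lead_below_def)
      next
        case n: False
        then have a: "?a \<in> G (n mod m)"
          using Suc.prems(1) K by (simp add: loop_power_def loop_algebra_def)
        show ?thesis
        proof (cases "(K, n) \<in> bad_positions D U")
          case True
          have "monomial K n ?a \<in> V.span (monomial K n ` A n)"
            using a A by (intro monomial_in_span) auto
          also have "\<dots> \<subseteq> V.span (U \<union> S)"
            unfolding S_def using True by (intro V.span_mono) auto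
          finally show ?thesis
            using K n a by (intro bexI[of _ "monomial K n ?a"])
              (auto simp: lead_below_def lookup_monomial monomial_apply_other
                intro: monomial_in_loop_power)
        next
          case False
          then have "?a \<in> leads U K n" using a n K by (auto simp: bad_positions_def)
          then obtain u where "u \<in> U" "lead_below K (Suc n) u" "Poly_Mapping.lookup (u K) n = ?a"
            unfolding leads_def by auto
          then show ?thesis using U(2) by (intro bexI[of _ u]) (auto intro: V.span_base)
        qed
      qed
      then obtain u where u: "u \<in> V.span (U \<union> S)" "u \<in> loop_power m G D" "lead_below K (Suc n) u"
        "Poly_Mapping.lookup (u K) n = ?a" by blast
      have "x - u \<in> loop_power m G D"
        using V.subspace_diff[OF subspace_loop_power Suc.prems(1) u(2)] .
      moreover have "lead_below K n (x - u)"
        using Suc.prems(2) u(3,4) unfolding lead_below_def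
        by (auto simp: lookup_minus le_Suc_eq Suc_le_eq) (metis diff_self le_neq_implies_less)
      ultimately have "x - u \<in> V.span (U \<union> S)" by (rule Suc.IH)
      from V.span_add[OF this u(1)] show ?case by simp
    qed
    \<comment> \<open>Finite support supplies the degree bound that starts the inner
      induction.\<close>
    obtain N where N: "\<And>n. Poly_Mapping.lookup (x K) n \<noteq> 0 \<Longrightarrow> n < N"
      using finite_nat_set_iff_bounded[THEN iffD1, OF finite_lookup[of "x K"]] by blast
    have "lead_below K N x"
      unfolding lead_below_def using Suc.prems(3) N by (metis Suc_leI not_less)
    then show ?case using inner Suc.prems(2) by blast
  qed
  show ?thesis using outer[of D] by (auto simp: loop_power_def)
qed

end

section \<open>Assembling the codimension estimate\<close>

theorem theorem8:
  fixes scale :: "'f::alg_closed_field \<Rightarrow> 'g::ab_group_add \<Rightarrow> 'g"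
    and bracket :: "'g \<Rightarrow> 'g \<Rightarrow> 'g"
    and m :: nat
    and G :: "nat \<Rightarrow> 'g set"
  assumes "alg_closure_of_finite_field TYPE('f)"
    and "graded_lie_algebra scale bracket m G"
    and "\<exists>B. finite_dimensional_vector_space scale B"
    and "derived_algebra scale bracket UNIV = UNIV"
  shows "\<exists>C::nat. \<forall>D>0. \<forall>H.
           H \<subseteq> loop_power m G D \<and>
           lie_subalgebra (power_scale scale) (power_bracket bracket) H \<and>
           codim (power_scale scale) (loop_power m G D) H < \<infinity> \<longrightarrow>
           codim (power_scale scale) (loop_power m G D)
               (derived_algebra (power_scale scale) (power_bracket bracket) H)
             \<le> enat C * (codim (power_scale scale) (loop_power m G D) H + enat D)"
proof -
  interpret graded_lie_algebra scale bracket m G by fact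
  interpret V: vector_space "power_scale scale"
    by (rule vector_space_power_scale) unfold_locales
  obtain E where "finite_dimensional_vector_space scale E" using assms(3) by blast
  then interpret E: finite_dimensional_vector_space scale E .
  \<comment> \<open>Generators are taken inside \<open>G (n mod m)\<close>, so that their monomials
    lie in \<open>loop_power m G D\<close>.\<close>
  have "\<exists>A. A \<subseteq> G (n mod m) \<and> G (n mod m) \<subseteq> span A \<and> finite A \<and> card A \<le> card E" for n
  proof -
    obtain A where A: "A \<subseteq> G (n mod m)" "independent A" "G (n mod m) \<subseteq> span A"
      by (rule basis_exists[of "G (n mod m)"])
    then show ?thesis
      using independent_span_bound[OF E.finite_Basis A(2)] E.span_Basis by auto
  qed
  then obtain A where A: "\<And>n. A n \<subseteq> G (n mod m)" "\<And>n. G (n mod m) \<subseteq> span (A n)"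
    "\<And>n. finite (A n)" "\<And>n. card (A n) \<le> card E"
    by metis
  show ?thesis
  \<comment> \<open>The factor \<open>2 * m\<close> comes from counting bad positions of the derived
    algebra; \<open>card E\<close>, the dimension of the graded algebra, bounds the generators
    needed at each of them.\<close>
  proof (intro exI[of _ "2 * m * card E"] allI impI, elim conjE)
    fix D :: nat and H
    assume HV: "H \<subseteq> loop_power m G D"
      and lie: "lie_subalgebra (power_scale scale) (power_bracket bracket) H"
      and cd: "codim (power_scale scale) (loop_power m G D) H < \<infinity>"
    let ?V = "loop_power m G D"
    let ?U = "derived_algebra (power_scale scale) (power_bracket bracket) H"
    have H: "V.subspace H" using lie by (simp add: lie_subalgebra_def)
    obtain B where B: "finite B" "quotient_basis (power_scale scale) ?V H B"
      using cd unfolding codim_def by (auto split: if_splits)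
    have cB: "codim (power_scale scale) ?V H = enat (card B)"
      by (rule V.codim_eq_card[OF H B])
    note bad = bad_positions_card_le[OF H B]
    have bad': "finite (bad_positions D ?U)"
      "card (bad_positions D ?U) \<le> 2 * m * (card (bad_positions D H) + D)"
      using card_bad_positions_derived[OF assms(4)] bad by auto
    have U: "V.subspace ?U" by (simp add: derived_algebra_def)
    have UV: "?U \<subseteq> ?V"
      unfolding derived_algebra_def using HV power_bracket_in_loop_power
      by (intro V.span_minimal subspace_loop_power) blast
    define S where "S = (\<Union>(k, n)\<in>bad_positions D ?U. monomial k n ` A n)"
    have "codim (power_scale scale) ?V ?U \<le> enat (card S)"
    proof (rule V.codim_le_card_spanning[OF U])
      show "finite S" using bad'(1) A(3) by (auto simp: S_def)
      show "S \<subseteq> ?V"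
        using A(1) by (auto simp: S_def bad_positions_def intro!: monomial_in_loop_power)
      show "?V \<subseteq> V.span (?U \<union> S)"
        unfolding S_def by (rule loop_power_subset_span[OF U UV A(2)])
    qed
    also have "card S \<le> 2 * m * card E * (card B + D)"
    proof -
      have "card S \<le> (\<Sum>p\<in>bad_positions D ?U. card ((\<lambda>(k, n). monomial k n ` A n) p))"
        unfolding S_def by (rule card_UN_le[OF bad'(1)])
      also have "\<dots> \<le> (\<Sum>p\<in>bad_positions D ?U. card E)"
        using A(3,4) by (intro sum_mono) (auto intro: order_trans[OF card_image_le])
      also have "\<dots> = card (bad_positions D ?U) * card E" by simp
      also have "\<dots> \<le> 2 * m * (card B + D) * card E"
        using bad bad'(2) by (intro mult_right_mono order_trans[OF bad'(2)] mult_left_mono) auto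
      finally show ?thesis by (simp add: algebra_simps)
    qed
    finally show "codim (power_scale scale) ?V ?U
        \<le> enat (2 * m * card E) * (codim (power_scale scale) ?V H + enat D)"
      by (simp add: cB)
  qed
qed

end
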